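(* Let $R[y]=\dfrac{J[y]}{I[y]}$, where $$J[y]=\sum_{k=1}^{N}\left[p(x_k)\left({_{0}}\Delta^{\alpha}_{k}y(x_k)\right)^2+q(x_k)(y(x_k))^2\right],\qquad I[y]=\sum_{k=1}^{N}r(x_{k})(y(x_{k}))^2,$$ be the Rayleigh quotient for the discrete fractional Sturm--Liouville problem $${_{k}}\Delta^{\alpha}_{N}\left(p(x_k)\,{_{0}}\Delta^{\alpha}_{k}y(x_k)\right)+q(x_k)y(x_k)=\lambda r(x_k)y(x_k), \quad k=1,\ldots,N-1,\qquad y(x_0)=y(x_N)=0.$$ Assume that $y:D\to\mathbb{R}$ satisfies the boundary conditions $y(x_0)=y(x_N)=0$ and is nontrivial. (i) If $y$ is a minimizer of $R$ (among nontrivial functions on $D$ vanishing at $x_0$ and $x_N$), then the value of $R$ at $y$ is equal to the smallest eigenvalue $\lambda_1$ of the Sturm--Liouville problem, i.e., $R[y]=\lambda_1$. (ii) If $y$ is a maximizer of $R$ (among nontrivial functions on $D$ vanishing at $x_0$ and $x_N$), then the value of $R$ at $y$ is equal to the largest eigenvalue $\lambda_{N-1}$ of the Sturm--Liouville problem, i.e., $R[y]=\lambda_{N-1}$.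
   Context: Let $a\in\mathbb{R}$, $h>0$, let $N\ge 2$ be an integer, and let $0<\alpha\le 1$. Put $x_j=a+jh$ for $j=0,1,\ldots,N$ and $D=\{x_0,\ldots,x_N\}$. Define $$a_0^{(\alpha)}:=1,\qquad a_i^{(\alpha)}:=(-1)^i\frac{\alpha(\alpha-1)\cdots(\alpha-i+1)}{i!}\quad (i=1,2,\ldots).$$ For $f:D\to\mathbb{R}$ and $k=0,\ldots,N$, the backward and forward (Grünwald--Letnikov) fractional differences of order $\alpha$ are $${_{0}}\Delta^{\alpha}_{k}f(x_k):=\frac{1}{h^{\alpha}}\sum_{i=0}^{k}a_i^{(\alpha)}f(x_{k-i}),\qquad {_{k}}\Delta^{\alpha}_{N}f(x_k):=\frac{1}{h^{\alpha}}\sum_{i=0}^{N-k}a_i^{(\alpha)}f(x_{k+i}).$$ In ${_{k}}\Delta^{\alpha}_{N}\left(p(x_k)\,{_{0}}\Delta^{\alpha}_{k}y(x_k)\right)$ the forward difference is applied to the function $x_j\mapsto p(x_j)\,{_{0}}\Delta^{\alpha}_{j}y(x_j)$ on $D$, evaluated at $x_k$. The functions $p,q,r:D\to\mathbb{R}$ satisfy $p(x_i)>0$ and $r(x_i)>0$ for all $i=0,\ldots,N$ ($q$ is an arbitrary real-valued function). The number $\lambda$ is a parameter. An eigenfunction is a nontrivial solution $y:D\to\mathbb{R}$ of the boundary value problem, and the corresponding value of $\lambda$ is an eigenvalue. The problem has $N-1$ real eigenvalues counted with multiplicity, ordered as $\lambda_1\le\lambda_2\le\cdots\le\lambda_{N-1}$.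 "Nontrivial" means not identically zero. *)

theory Defs
  imports Complex_Main "HOL-Library.Function_Algebras"
begin

text \<open>
  A function on the grid \<open>D = {x\<^sub>0, \<dots>, x\<^sub>N}\<close> is represented by a total function
  \<open>real \<Rightarrow> real\<close> of which only the values on \<open>D\<close> are used.
\<close>

definition grid :: "real \<Rightarrow> real \<Rightarrow> nat \<Rightarrow> real" where
  "grid a h j = a + real j * h"

definition grid_set :: "real \<Rightarrow> real \<Rightarrow> nat \<Rightarrow> real set" where
  "grid_set a h N = grid a h ` {0..N}"

definition gl_coeff :: "real \<Rightarrow> nat \<Rightarrow> real" where
  "gl_coeff \<alpha> i = (-1) ^ i * (\<alpha> gchoose i)"

text \<open>
  The difference operators act on the sequence of grid values: \<open>f j\<close> stands for the value at
  \<open>x\<^sub>j\<close> of the function being differenced.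
\<close>

definition backward_diff :: "real \<Rightarrow> real \<Rightarrow> (nat \<Rightarrow> real) \<Rightarrow> nat \<Rightarrow> real" where
  "backward_diff h \<alpha> f k = 1 / h powr \<alpha> * (\<Sum>i=0..k. gl_coeff \<alpha> i * f (k - i))"

definition forward_diff :: "real \<Rightarrow> real \<Rightarrow> nat \<Rightarrow> (nat \<Rightarrow> real) \<Rightarrow> nat \<Rightarrow> real" where
  "forward_diff h \<alpha> N f k = 1 / h powr \<alpha> * (\<Sum>i=0..N - k. gl_coeff \<alpha> i * f (k + i))"

definition SL_boundary :: "real \<Rightarrow> real \<Rightarrow> nat \<Rightarrow> (real \<Rightarrow> real) \<Rightarrow> bool" where
  "SL_boundary a h N y \<longleftrightarrow> y (grid a h 0) = 0 \<and> y (grid a h N) = 0"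

definition SL_nontrivial :: "real \<Rightarrow> real \<Rightarrow> nat \<Rightarrow> (real \<Rightarrow> real) \<Rightarrow> bool" where
  "SL_nontrivial a h N y \<longleftrightarrow> (\<exists>t\<in>grid_set a h N. y t \<noteq> 0)"

definition SL_solution ::
  "real \<Rightarrow> real \<Rightarrow> real \<Rightarrow> nat \<Rightarrow> (real \<Rightarrow> real) \<Rightarrow> (real \<Rightarrow> real) \<Rightarrow> (real \<Rightarrow> real)
    \<Rightarrow> real \<Rightarrow> (real \<Rightarrow> real) \<Rightarrow> bool" where
  "SL_solution a h \<alpha> N p q r \<mu> y \<longleftrightarrow>
    (\<forall>k\<in>{1..N - 1}.
       forward_diff h \<alpha> N
         (\<lambda>j. p (grid a h j) * backward_diff h \<alpha> (\<lambda>i. y (grid a h i)) j) k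
       + q (grid a h k) * y (grid a h k) = \<mu> * r (grid a h k) * y (grid a h k))
    \<and> SL_boundary a h N y"

definition SL_eigenvalue ::
  "real \<Rightarrow> real \<Rightarrow> real \<Rightarrow> nat \<Rightarrow> (real \<Rightarrow> real) \<Rightarrow> (real \<Rightarrow> real) \<Rightarrow> (real \<Rightarrow> real)
    \<Rightarrow> real \<Rightarrow> bool" where
  "SL_eigenvalue a h \<alpha> N p q r \<mu> \<longleftrightarrow>
    (\<exists>y. SL_nontrivial a h N y \<and> SL_solution a h \<alpha> N p q r \<mu> y)"

text \<open>
  Vanishing outside \<open>D\<close> makes every function on \<open>D\<close> have exactly one representative, so that the
  dimension below is that of a space of functions on \<open>D\<close>.
\<close>

definition SL_eigenspace ::
  "real \<Rightarrow> real \<Rightarrow> real \<Rightarrow> nat \<Rightarrow> (real \<Rightarrow> real) \<Rightarrow> (real \<Rightarrow> real) \<Rightarrow> (real \<Rightarrow> real)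
    \<Rightarrow> real \<Rightarrow> (real \<Rightarrow> real) set" where
  "SL_eigenspace a h \<alpha> N p q r \<mu> =
    {y. SL_solution a h \<alpha> N p q r \<mu> y \<and> (\<forall>t. t \<notin> grid_set a h N \<longrightarrow> y t = 0)}"

definition SL_multiplicity ::
  "real \<Rightarrow> real \<Rightarrow> real \<Rightarrow> nat \<Rightarrow> (real \<Rightarrow> real) \<Rightarrow> (real \<Rightarrow> real) \<Rightarrow> (real \<Rightarrow> real)
    \<Rightarrow> real \<Rightarrow> nat" where
  "SL_multiplicity a h \<alpha> N p q r \<mu> =
    vector_space.dim (\<lambda>(c::real) (f :: real \<Rightarrow> real) t. c * f t)
      (SL_eigenspace a h \<alpha> N p q r \<mu>)"

text \<open>
  The eigenvalues in increasing order, each repeated according to its multiplicity. There are only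
  finitely many of them, as \<open>sorted_list_of_set\<close> requires: the equations for \<open>k = 1, \<dots>, N - 1\<close>
  amount to an eigenvalue problem for a matrix of size \<open>N - 1\<close>, because \<open>r > 0\<close> on \<open>D\<close>.
\<close>

definition SL_eigenvalues ::
  "real \<Rightarrow> real \<Rightarrow> real \<Rightarrow> nat \<Rightarrow> (real \<Rightarrow> real) \<Rightarrow> (real \<Rightarrow> real) \<Rightarrow> (real \<Rightarrow> real)
    \<Rightarrow> real list" where
  "SL_eigenvalues a h \<alpha> N p q r =
    concat (map (\<lambda>\<mu>. replicate (SL_multiplicity a h \<alpha> N p q r \<mu>) \<mu>)
      (sorted_list_of_set {\<mu>. SL_eigenvalue a h \<alpha> N p q r \<mu>}))"

text \<open>\<open>\<lambda>\<^sub>i\<close> for \<open>i = 1, \<dots>, N - 1\<close>; list positions start at \<open>0\<close>.\<close>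

definition SL_lambda ::
  "real \<Rightarrow> real \<Rightarrow> real \<Rightarrow> nat \<Rightarrow> (real \<Rightarrow> real) \<Rightarrow> (real \<Rightarrow> real) \<Rightarrow> (real \<Rightarrow> real)
    \<Rightarrow> nat \<Rightarrow> real" where
  "SL_lambda a h \<alpha> N p q r i = SL_eigenvalues a h \<alpha> N p q r ! (i - 1)"

definition SL_J ::
  "real \<Rightarrow> real \<Rightarrow> real \<Rightarrow> nat \<Rightarrow> (real \<Rightarrow> real) \<Rightarrow> (real \<Rightarrow> real) \<Rightarrow> (real \<Rightarrow> real) \<Rightarrow> real" where
  "SL_J a h \<alpha> N p q y =
    (\<Sum>k=1..N. p (grid a h k) * (backward_diff h \<alpha> (\<lambda>i. y (grid a h i)) k)\<^sup>2
       + q (grid a h k) * (y (grid a h k))\<^sup>2)"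

definition SL_I :: "real \<Rightarrow> real \<Rightarrow> nat \<Rightarrow> (real \<Rightarrow> real) \<Rightarrow> (real \<Rightarrow> real) \<Rightarrow> real" where
  "SL_I a h N r y = (\<Sum>k=1..N. r (grid a h k) * (y (grid a h k))\<^sup>2)"

definition rayleigh ::
  "real \<Rightarrow> real \<Rightarrow> real \<Rightarrow> nat \<Rightarrow> (real \<Rightarrow> real) \<Rightarrow> (real \<Rightarrow> real) \<Rightarrow> (real \<Rightarrow> real)
    \<Rightarrow> (real \<Rightarrow> real) \<Rightarrow> real" where
  "rayleigh a h \<alpha> N p q r y = SL_J a h \<alpha> N p q y / SL_I a h N r y"

end

theory Submission
  imports Defs
begin

text \<open>
  The numerator and the denominator of the Rayleigh quotient are the quadratic forms of two symmetric
  bilinear forms, \<open>energy_form\<close> and \<open>weight_form\<close>, on the space \<open>admissible\<close> of functions on the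
  grid that vanish at both ends. Forward and backward differences are adjoint to each other
  (\<open>summation_by_parts\<close>), so the boundary value problem says exactly that \<open>y\<close> vanishes at
  both ends and \<open>energy_form y z = \<mu> * weight_form y z\<close> for all admissible \<open>z\<close>
  (\<open>SL_solution_iff_weak\<close>). The eigenvalues are thus those of one symmetric form relative to another, positive definite one.

  For such a pair of forms on a finite-dimensional space there is an orthogonal basis of eigenvectors
  (\<open>eigenvector_basis\<close>). Hence an eigenspace is spanned by the basis vectors that belong to it, its
  dimension counts them, and the list of eigenvalues with multiplicities has as many entries as the
  space has dimensions, here \<open>N - 1\<close>; this is why the entry number \<open>N - 1\<close> is the largest one. In the
  basis the Rayleigh quotient is a weighted mean of eigenvalues, so it lies between the first and the
  last entry of the list and takes both values at eigenvectors (\<open>extreme_eigenvalues\<close>). A minimizer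
  or maximizer must therefore give the corresponding entry.

  The analytic core is the existence of one eigenvector (\<open>exists_eigenvector\<close>). Compactness is
  avoided as follows. Let \<open>m\<close> be the infimum of the quotient \<open>A v v / P v v\<close>. The form \<open>A - m P\<close> is
  positive semidefinite; were it definite, it would dominate a positive multiple of \<open>P\<close>, because
  definite forms on a finite-dimensional space dominate all others up to constants
  (\<open>positive_form_dominates\<close>), and \<open>m\<close> could be increased. So \<open>A - m P\<close> has a null vector, which is an eigenvector for \<open>m\<close>.
\<close>

section \<open>Orthogonal systems of symmetric bilinear forms\<close>

locale real_space = vector_space scale
  for scale :: "real \<Rightarrow> 'b::ab_group_add \<Rightarrow> 'b" (infixr "*s" 75)
begin

definition symmetric_form :: "('b \<Rightarrow> 'b \<Rightarrow> real) \<Rightarrow> bool" where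
  "symmetric_form P \<longleftrightarrow> (\<forall>x y. P x y = P y x) \<and> (\<forall>x y z. P (x + y) z = P x z + P y z)
     \<and> (\<forall>c x z. P (c *s x) z = c * P x z)"

definition positive_on :: "('b \<Rightarrow> 'b \<Rightarrow> real) \<Rightarrow> 'b set \<Rightarrow> bool" where
  "positive_on P W \<longleftrightarrow> (\<forall>v\<in>W. v \<noteq> 0 \<longrightarrow> P v v > 0)"

text \<open>
  Positivity is required at the members only, so that a system can be orthogonal for a form that is
  positive definite merely on a subspace.
\<close>

definition orthogonal_system :: "('b \<Rightarrow> 'b \<Rightarrow> real) \<Rightarrow> 'b set \<Rightarrow> bool" where
  "orthogonal_system P S \<longleftrightarrow>
     finite S \<and> (\<forall>s\<in>S. P s s > 0) \<and> (\<forall>s\<in>S. \<forall>t\<in>S. s \<noteq> t \<longrightarrow> P s t = 0)"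

lemma
  assumes "symmetric_form P"
  shows form_commute: "P x y = P y x"
    and form_add_left: "P (x + y) z = P x z + P y z"
    and form_scale_left: "P (c *s x) z = c * P x z"
  using assms unfolding symmetric_form_def by blast+

lemma
  assumes "symmetric_form P"
  shows form_add_right: "P z (x + y) = P z x + P z y"
    and form_scale_right: "P z (c *s x) = c * P z x"
  using assms unfolding symmetric_form_def by metis+

lemma form_zero_left: assumes "symmetric_form P" shows "P 0 z = 0"
  using form_scale_left[OF assms, of 0 0 z] by simp

lemma form_diff_left: assumes "symmetric_form P" shows "P (x - y) z = P x z - P y z"
  using form_add_left[OF assms, of "x - y" y z] by simp

lemma form_sum_left:
  assumes "symmetric_form P" shows "P (\<Sum>i\<in>T. f i) z = (\<Sum>i\<in>T. P (f i) z)"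
  by (induction T rule: infinite_finite_induct)
     (simp_all add: form_zero_left[OF assms] form_add_left[OF assms])

lemma form_sum_right:
  assumes "symmetric_form P" shows "P z (\<Sum>i\<in>T. f i) = (\<Sum>i\<in>T. P z (f i))"
  using form_sum_left[OF assms, of f T z] by (simp add: form_commute[OF assms, of z])

lemma symmetric_form_minus_multiple:
  assumes "symmetric_form A" "symmetric_form P"
  shows "symmetric_form (\<lambda>x y. A x y - m * P x y)"
  unfolding symmetric_form_def
  by (intro conjI allI; (subst form_commute[OF assms(1)], subst form_commute[OF assms(2)], rule refl)?)
     (simp_all add: form_add_left[OF assms(1)] form_add_left[OF assms(2)]
      form_scale_left[OF assms(1)] form_scale_left[OF assms(2)] right_diff_distrib distrib_left
      mult.left_commute)

lemma form_combination:
  assumes P: "symmetric_form P" and S: "orthogonal_system P S" and t: "t \<in> S"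
  shows "P (\<Sum>s\<in>S. u s *s s) t = u t * P t t"
proof -
  have "P (\<Sum>s\<in>S. u s *s s) t = (\<Sum>s\<in>S. if s = t then u t * P t t else 0)"
    unfolding form_sum_left[OF P] form_scale_left[OF P]
    using S t by (intro sum.cong) (auto simp: orthogonal_system_def)
  then show ?thesis
    using S t by (simp add: orthogonal_system_def)
qed

lemma orthogonal_system_independent:
  assumes P: "symmetric_form P" and S: "orthogonal_system P S"
  shows "independent S"
proof
  assume "dependent S"
  then obtain u v where v: "v \<in> S" "u v \<noteq> 0" and "(\<Sum>s\<in>S. u s *s s) = 0"
    using S dependent_finite[of S] by (auto simp: orthogonal_system_def)
  then have "u v * P v v = 0"
    using form_combination[OF P S v(1), of u] form_zero_left[OF P] by simp
  then show False
    using v S by (auto simp: orthogonal_system_def)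
qed

lemma fourier_expansion:
  assumes P: "symmetric_form P" and S: "orthogonal_system P S" and v: "v \<in> span S"
  shows "v = (\<Sum>s\<in>S. (P v s / P s s) *s s)"
proof -
  obtain u where u: "v = (\<Sum>s\<in>S. u s *s s)"
    using v span_finite[of S] S by (auto simp: orthogonal_system_def)
  have "P v s / P s s = u s" if "s \<in> S" for s
    using form_combination[OF P S that, of u] S that
    by (auto simp: u orthogonal_system_def)
  then show ?thesis
    using u by simp
qed

lemma orthogonal_remainder:
  assumes P: "symmetric_form P" and S: "orthogonal_system P S" and t: "t \<in> S"
  shows "P (v - (\<Sum>s\<in>S. (P v s / P s s) *s s)) t = 0"
  using form_combination[OF P S t, of "\<lambda>s. P v s / P s s"] S t
  by (auto simp: form_diff_left[OF P] orthogonal_system_def)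

text \<open>
  An orthogonal system in \<open>W\<close> is independent, so its cardinality is bounded; one of largest cardinality
  cannot be extended and must span \<open>W\<close>. The predicate \<open>\<Phi>\<close> serves to build a plain orthogonal basis as
  well as a basis of eigenvectors.
\<close>

lemma orthogonal_basis_by_extension:
  assumes P: "symmetric_form P" and pos: "positive_on P W"
    and F: "finite F" "W \<subseteq> span F"
    and extend: "\<And>S. \<lbrakk>S \<subseteq> W; orthogonal_system P S; \<forall>s\<in>S. \<Phi> s; \<not> W \<subseteq> span S\<rbrakk>
      \<Longrightarrow> \<exists>w\<in>W. w \<noteq> 0 \<and> \<Phi> w \<and> (\<forall>s\<in>S. P w s = 0)"
  obtains S where "S \<subseteq> W" "orthogonal_system P S" "\<forall>s\<in>S. \<Phi> s" "W \<subseteq> span S"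
proof -
  define good where "good S \<longleftrightarrow> S \<subseteq> W \<and> orthogonal_system P S \<and> (\<forall>s\<in>S. \<Phi> s)" for S
  have bound: "\<forall>S. good S \<longrightarrow> card S < Suc (card F)"
    using independent_span_bound[OF F(1)] orthogonal_system_independent[OF P] F(2)
    unfolding good_def by (meson le_imp_less_Suc order_trans)
  have "good {}"
    by (simp add: good_def orthogonal_system_def)
  from ex_has_greatest_nat[of good, OF this bound]
  obtain S where S: "good S" and max: "\<And>T. good T \<Longrightarrow> card T \<le> card S"
    by blast
  have "W \<subseteq> span S"
  proof (rule ccontr)
    assume "\<not> W \<subseteq> span S"
    then obtain w where w: "w \<in> W" "w \<noteq> 0" "\<Phi> w" "\<forall>s\<in>S. P w s = 0"
      using extend[of S] S by (auto simp: good_def)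
    have pw: "P w w > 0" using w pos by (simp add: positive_on_def)
    then have notin: "w \<notin> S" using w(4) by auto
    have "P s w = 0" if "s \<in> S" for s
      using w(4) that form_commute[OF P, of s w] by simp
    then have "good (insert w S)"
      using S w pw by (auto simp: good_def orthogonal_system_def)
    then show False
      using max[of "insert w S"] notin S by (simp add: good_def orthogonal_system_def)
  qed
  then show thesis
    using that S by (auto simp: good_def)
qed

text \<open>
  One Gram--Schmidt step: a vector outside the span minus its orthogonal projection.
\<close>

lemma exists_orthogonal_vector:
  assumes P: "symmetric_form P" and W: "subspace W" and S: "orthogonal_system P S" "S \<subseteq> W"
    and nspan: "\<not> W \<subseteq> span S"
  shows "\<exists>w\<in>W. w \<noteq> 0 \<and> (\<forall>s\<in>S. P w s = 0)"
proof -
  obtain v where v: "v \<in> W" "v \<notin> span S" using nspan by blast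
  define w where "w = v - (\<Sum>s\<in>S. (P v s / P s s) *s s)"
  have "(\<Sum>s\<in>S. (P v s / P s s) *s s) \<in> span S"
    by (intro span_sum span_scale span_base)
  moreover have "(\<Sum>s\<in>S. (P v s / P s s) *s s) \<in> W"
    using S(2) by (intro subspace_sum[OF W] subspace_scale[OF W]) auto
  ultimately have "w \<in> W" "w \<noteq> 0"
    using v subspace_diff[OF W] by (auto simp: w_def)
  then show ?thesis
    using orthogonal_remainder[OF P S(1)] unfolding w_def by blast
qed

section \<open>Eigenvectors of a pair of forms\<close>

text \<open>
  In a \<open>P\<close>-orthogonal basis, \<open>P v v\<close> is a positively weighted sum of the squared coordinates of \<open>v\<close> and
  therefore controls each of them, hence every quadratic expression in them.
\<close>

lemma positive_form_dominates:
  assumes P: "symmetric_form P" and pos: "positive_on P W" and W: "subspace W"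
    and F: "finite F" "W \<subseteq> span F" and T: "symmetric_form T"
  obtains C where "C > 0" "\<And>v. v \<in> W \<Longrightarrow> T v v \<le> C * P v v"
proof -
  obtain S where SW: "S \<subseteq> W" and S: "orthogonal_system P S" and WS: "W \<subseteq> span S"
    using orthogonal_basis_by_extension[OF P pos F, of "\<lambda>_. True"]
      exists_orthogonal_vector[OF P W] by auto
  have fin: "finite S" and ps: "\<And>s. s \<in> S \<Longrightarrow> P s s > 0"
    using S by (auto simp: orthogonal_system_def)
  define C where "C = (\<Sum>s\<in>S. \<Sum>t\<in>S. (1 / P s s + 1 / P t t) * \<bar>T s t\<bar>)"
  have C: "T v v \<le> C * P v v" if v: "v \<in> W" for v
  proof -
    define c where "c s = P v s / P s s" for s
    have v_eq: "v = (\<Sum>s\<in>S. c s *s s)"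
      using fourier_expansion[OF P S] v WS by (auto simp: c_def)
    have "P v v = (\<Sum>s\<in>S. c s * P s v)"
      by (subst v_eq) (simp add: form_sum_left[OF P] form_scale_left[OF P])
    also have "\<dots> = (\<Sum>s\<in>S. (c s)\<^sup>2 * P s s)"
      using ps by (intro sum.cong)
        (auto simp: c_def form_commute[OF P, of v] power2_eq_square less_imp_neq)
    finally have Pv: "P v v = (\<Sum>s\<in>S. (c s)\<^sup>2 * P s s)" .
    \<comment> \<open>A single summand of the formula for \<open>P v v\<close> is at most the whole sum.\<close>
    have coeff: "(c s)\<^sup>2 \<le> 1 / P s s * P v v" if "s \<in> S" for s
    proof -
      have "(c s)\<^sup>2 * P s s \<le> P v v"
        unfolding Pv using that fin ps
        by (intro member_le_sum) (auto intro!: mult_nonneg_nonneg simp: less_imp_le)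
      then show ?thesis
        using ps[OF that] by (simp add: field_simps)
    qed
    have entry: "c s * c t * T s t \<le> (1 / P s s + 1 / P t t) * \<bar>T s t\<bar> * P v v"
      if "s \<in> S" "t \<in> S" for s t
    proof -
      have "2 * \<bar>c s * c t\<bar> \<le> (c s)\<^sup>2 + (c t)\<^sup>2"
        using sum_squares_bound[of "\<bar>c s\<bar>" "\<bar>c t\<bar>"] by (simp add: abs_mult)
      moreover have "0 \<le> (c s)\<^sup>2 + (c t)\<^sup>2" by simp
      ultimately have "\<bar>c s * c t\<bar> \<le> (c s)\<^sup>2 + (c t)\<^sup>2" by linarith
      also have "\<dots> \<le> (1 / P s s + 1 / P t t) * P v v"
        using coeff[OF that(1)] coeff[OF that(2)] by (simp add: distrib_right)
      finally have "\<bar>c s * c t\<bar> * \<bar>T s t\<bar> \<le> (1 / P s s + 1 / P t t) * P v v * \<bar>T s t\<bar>"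
        by (intro mult_right_mono) auto
      moreover have "c s * c t * T s t \<le> \<bar>c s * c t\<bar> * \<bar>T s t\<bar>"
        by (metis abs_ge_self abs_mult)
      ultimately show ?thesis by (simp add: mult_ac)
    qed
    have "T v v = (\<Sum>s\<in>S. c s * T s v)"
      by (subst v_eq) (simp add: form_sum_left[OF T] form_scale_left[OF T])
    also have "\<dots> = (\<Sum>s\<in>S. \<Sum>t\<in>S. c s * c t * T s t)"
      by (subst v_eq)
        (simp add: form_sum_right[OF T] form_scale_right[OF T] sum_distrib_left mult.assoc)
    also have "\<dots> \<le> (\<Sum>s\<in>S. \<Sum>t\<in>S. (1 / P s s + 1 / P t t) * \<bar>T s t\<bar> * P v v)"
      using entry by (intro sum_mono) auto
    also have "\<dots> = C * P v v"
      by (simp add: C_def sum_distrib_right)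
    finally show ?thesis .
  qed
  have "P v v \<ge> 0" if "v \<in> W" for v
    using pos that form_zero_left[OF P] by (cases "v = 0") (auto simp: positive_on_def less_imp_le)
  then have "T v v \<le> (\<bar>C\<bar> + 1) * P v v" if "v \<in> W" for v
    using C[OF that] that mult_right_mono[of C "\<bar>C\<bar> + 1" "P v v"] by fastforce
  then show thesis
    using that[of "\<bar>C\<bar> + 1"] by simp
qed

text \<open>
  Otherwise \<open>Q (u + t *s w) (u + t *s w) = 2 * t * Q u w + t\<^sup>2 * Q w w\<close> would be negative for a
  suitable small \<open>t\<close> of the sign opposite to \<open>Q u w\<close>.
\<close>

lemma semidefinite_form_null_vector:
  assumes Q: "symmetric_form Q" and W: "subspace W" and nonneg: "\<And>v. v \<in> W \<Longrightarrow> Q v v \<ge> 0"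
    and u: "u \<in> W" "Q u u = 0" and w: "w \<in> W"
  shows "Q u w = 0"
proof (rule ccontr)
  assume ne: "Q u w \<noteq> 0"
  define b where "b = Q u w"
  \<comment> \<open>Adding 1 keeps the denominator of \<open>t\<close> positive when \<open>Q w w = 0\<close>.\<close>
  define d where "d = Q w w + 1"
  have d: "d > 0" using nonneg[OF w] by (simp add: d_def)
  define t where "t = - b / d"
  have "u + t *s w \<in> W"
    using u w W by (intro subspace_add subspace_scale)
  then have "0 \<le> Q (u + t *s w) (u + t *s w)" by (rule nonneg)
  also have "\<dots> = 2 * t * b + t\<^sup>2 * (d - 1)"
    by (simp add: form_add_left[OF Q] form_add_right[OF Q] form_scale_left[OF Q]
        form_scale_right[OF Q] u(2) b_def d_def form_commute[OF Q, of w u] power2_eq_square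
        algebra_simps)
  also have "\<dots> = - (b\<^sup>2 / d) - t\<^sup>2"
    using d by (simp add: t_def power2_eq_square field_simps)
  also have "\<dots> < 0"
  proof -
    have "b\<^sup>2 / d > 0" using ne d by (simp add: b_def)
    moreover have "t\<^sup>2 \<ge> 0" by simp
    ultimately show ?thesis by linarith
  qed
  finally show False by simp
qed

text \<open>
  The eigenvalue is the infimum \<open>m\<close> of the Rayleigh quotient. If \<open>A - m P\<close> had no null vector, it would be
  positive definite, so \<open>P \<le> C (A - m P)\<close> for some \<open>C > 0\<close>, which makes the quotient at least \<open>m + 1 / C\<close>
  everywhere.
\<close>

lemma exists_eigenvector:
  assumes A: "symmetric_form A" and P: "symmetric_form P" and pos: "positive_on P W"
    and W: "subspace W" and F: "finite F" "W \<subseteq> span F" and nz: "\<exists>w\<in>W. w \<noteq> 0"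
  shows "\<exists>u\<in>W. u \<noteq> 0 \<and> (\<exists>\<mu>. \<forall>v\<in>W. A u v = \<mu> * P u v)"
proof -
  define X where "X = (\<lambda>v. A v v / P v v) ` (W - {0})"
  define m where "m = Inf X"
  define Q where "Q x y = A x y - m * P x y" for x y
  have Q: "symmetric_form Q"
    unfolding Q_def using A P by (rule symmetric_form_minus_multiple)
  have X_ne: "X \<noteq> {}" using nz by (auto simp: X_def)
  have pP: "P v v > 0" if "v \<in> W" "v \<noteq> 0" for v
    using pos that by (simp add: positive_on_def)
  \<comment> \<open>Domination applied to \<open>- A\<close> bounds the quotient from below, so the infimum is meaningful.\<close>
  have "symmetric_form (\<lambda>_ _. 0)" by (simp add: symmetric_form_def)
  from symmetric_form_minus_multiple[OF this A, of 1]
  have "symmetric_form (\<lambda>x y. 0 - 1 * A x y)" .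
  then obtain C0 where C0: "\<And>v. v \<in> W \<Longrightarrow> 0 - 1 * A v v \<le> C0 * P v v"
    using positive_form_dominates[OF P pos W F] by metis
  have "- C0 \<le> x" if "x \<in> X" for x
    using that C0 pP by (fastforce simp: X_def field_simps)
  then have "bdd_below X" by (rule bdd_belowI)
  then have m_le: "m \<le> A v v / P v v" if "v \<in> W" "v \<noteq> 0" for v
    using that unfolding m_def X_def by (intro cInf_lower) auto
  have "Q v v \<ge> 0" if "v \<in> W" "v \<noteq> 0" for v
    using m_le[OF that] pP[OF that] by (simp add: Q_def pos_le_divide_eq)
  then have nonneg: "Q v v \<ge> 0" if "v \<in> W" for v
    using that form_zero_left[OF Q] by (cases "v = 0") auto
  have "\<exists>u\<in>W. u \<noteq> 0 \<and> Q u u = 0"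
  proof (rule ccontr)
    assume "\<not> ?thesis"
    then have "positive_on Q W"
      using nonneg by (force simp: positive_on_def)
    then obtain C where C: "C > 0" "\<And>v. v \<in> W \<Longrightarrow> P v v \<le> C * Q v v"
      using positive_form_dominates[OF Q _ W F P] by blast
    have "m + 1 / C \<le> x" if "x \<in> X" for x
    proof -
      obtain v where v: "v \<in> W" "v \<noteq> 0" "x = A v v / P v v" using \<open>x \<in> X\<close> by (auto simp: X_def)
      have "P v v / C \<le> A v v - m * P v v"
        using C(1) C(2)[OF v(1)] by (simp add: Q_def field_simps)
      then have "(m + 1 / C) * P v v \<le> A v v" by (simp add: algebra_simps)
      then show ?thesis
        using pP[OF v(1,2)] by (simp add: v(3) pos_le_divide_eq)
    qed
    then have "m + 1 / C \<le> m"
      unfolding m_def using X_ne by (intro cInf_greatest) auto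
    then show False using C(1) by simp
  qed
  then obtain u where u: "u \<in> W" "u \<noteq> 0" "Q u u = 0" by blast
  have "A u v = m * P u v" if "v \<in> W" for v
    using semidefinite_form_null_vector[OF Q W nonneg u(1,3) that] by (simp add: Q_def)
  then show ?thesis using u by blast
qed

text \<open>
  The eigenvalue equation is stated in weak form, tested against all of \<open>V\<close>; no operator on \<open>V\<close> has to
  be chosen.
\<close>

definition eigenspace :: "('b \<Rightarrow> 'b \<Rightarrow> real) \<Rightarrow> ('b \<Rightarrow> 'b \<Rightarrow> real) \<Rightarrow> 'b set \<Rightarrow> real \<Rightarrow> 'b set" where
  "eigenspace A P V \<mu> = {u\<in>V. \<forall>v\<in>V. A u v = \<mu> * P u v}"

lemma subspace_eigenspace:
  assumes A: "symmetric_form A" and P: "symmetric_form P" and V: "subspace V"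
  shows "subspace (eigenspace A P V \<mu>)"
  using V by (auto simp: subspace_def eigenspace_def form_zero_left[OF A] form_zero_left[OF P]
      form_add_left[OF A] form_add_left[OF P] form_scale_left[OF A] form_scale_left[OF P]
      algebra_simps)

text \<open>
  The orthogonal complement \<open>W\<close> of a system \<open>S\<close> of eigenvectors contains a vector \<open>u\<close> that satisfies the
  eigenvalue equation against all of \<open>W\<close>. It also satisfies it against \<open>S\<close>, where both sides vanish, and
  \<open>V\<close> is the sum of \<open>W\<close> and the span of \<open>S\<close>. So \<open>S\<close> can be extended until it spans \<open>V\<close>.
\<close>

lemma eigenvector_basis:
  assumes A: "symmetric_form A" and P: "symmetric_form P" and pos: "positive_on P V"
    and V: "subspace V" and F: "finite F" "V \<subseteq> span F"
  obtains S ev where "orthogonal_system P S" "span S = V"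
    "\<And>s. s \<in> S \<Longrightarrow> s \<in> eigenspace A P V (ev s)"
proof -
  have extend: "\<exists>w\<in>V. w \<noteq> 0 \<and> (\<exists>\<mu>. w \<in> eigenspace A P V \<mu>) \<and> (\<forall>s\<in>S. P w s = 0)"
    if SV: "S \<subseteq> V" and S: "orthogonal_system P S"
      and ES: "\<forall>s\<in>S. \<exists>\<mu>. s \<in> eigenspace A P V \<mu>" and nspan: "\<not> V \<subseteq> span S" for S
  proof -
    define W where "W = {v\<in>V. \<forall>s\<in>S. P v s = 0}"
    have W: "subspace W"
      using V by (auto simp: subspace_def W_def form_zero_left[OF P] form_add_left[OF P]
          form_scale_left[OF P])
    have "positive_on P W" "W \<subseteq> span F" "\<exists>w\<in>W. w \<noteq> 0"
      using pos F exists_orthogonal_vector[OF P V S SV nspan] by (auto simp: W_def positive_on_def)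
    then obtain u \<mu> where u: "u \<in> W" "u \<noteq> 0" and eig: "\<forall>v\<in>W. A u v = \<mu> * P u v"
      using exists_eigenvector[OF A P _ W F(1)] by blast
    have orth: "P u s = 0" if "s \<in> S" for s
      using u that by (simp add: W_def)
    have AS: "A u s = 0" if s: "s \<in> S" for s
    proof -
      obtain \<nu> where "A s u = \<nu> * P s u"
        using ES s u unfolding eigenspace_def W_def by blast
      then show ?thesis
        using orth[OF s] by (simp add: form_commute[OF A, of u] form_commute[OF P, of s])
    qed
    have "A u v = \<mu> * P u v" if v: "v \<in> V" for v
    proof -
      define g where "g = (\<Sum>s\<in>S. (P v s / P s s) *s s)"
      have "g \<in> V"
        unfolding g_def using SV by (intro subspace_sum[OF V] subspace_scale[OF V]) auto
      then have "v - g \<in> W"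
        using v orthogonal_remainder[OF P S] subspace_diff[OF V] by (simp add: W_def g_def)
      then have "A u (v - g) = \<mu> * P u (v - g)" using eig by blast
      moreover have "A u g = 0" "P u g = 0"
        by (simp_all add: g_def form_sum_right[OF A] form_sum_right[OF P]
            form_scale_right[OF A] form_scale_right[OF P] orth AS)
      ultimately show ?thesis
        using form_add_right[OF A, of u "v - g" g] form_add_right[OF P, of u "v - g" g] by simp
    qed
    then show ?thesis
      using u by (auto simp: W_def eigenspace_def)
  qed
  obtain S where S: "S \<subseteq> V" "orthogonal_system P S" "\<forall>s\<in>S. \<exists>\<mu>. s \<in> eigenspace A P V \<mu>"
    "V \<subseteq> span S"
    using orthogonal_basis_by_extension[OF P pos F extend] by blast
  then obtain ev where "\<forall>s\<in>S. s \<in> eigenspace A P V (ev s)" by metis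
  moreover have "span S = V"
    using S V span_minimal by blast
  ultimately show thesis using that S by blast
qed

text \<open>
  Eigenvectors for different eigenvalues are orthogonal, so the expansion of an eigenvector in the basis
  involves only basis vectors with the same eigenvalue.
\<close>

lemma eigenspace_eq_span:
  assumes A: "symmetric_form A" and P: "symmetric_form P"
    and S: "orthogonal_system P S" "span S = V"
    and ev: "\<And>s. s \<in> S \<Longrightarrow> s \<in> eigenspace A P V (ev s)"
  shows "eigenspace A P V \<mu> = span {s\<in>S. ev s = \<mu>}"
proof
  have V: "subspace V" using subspace_span[of S] S(2) by simp
  show "span {s\<in>S. ev s = \<mu>} \<subseteq> eigenspace A P V \<mu>"
    using ev by (intro span_minimal subspace_eigenspace[OF A P V]) auto
  show "eigenspace A P V \<mu> \<subseteq> span {s\<in>S. ev s = \<mu>}"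
  proof
    fix u assume u: "u \<in> eigenspace A P V \<mu>"
    have uV: "u \<in> V" and SV: "S \<subseteq> V" using u S(2) span_superset by (auto simp: eigenspace_def)
    have zero: "P u s = 0" if s: "s \<in> S" "ev s \<noteq> \<mu>" for s
    proof -
      have "A u s = \<mu> * P u s" using u s SV by (auto simp: eigenspace_def)
      moreover have "A s u = ev s * P s u" using ev[OF s(1)] uV by (simp add: eigenspace_def)
      ultimately have "(ev s - \<mu>) * P u s = 0"
        using form_commute[OF A, of s u] form_commute[OF P, of s u]
        by (simp only: left_diff_distrib diff_self)
      then show ?thesis using s by auto
    qed
    have "u = (\<Sum>s\<in>S. (P u s / P s s) *s s)"
      using fourier_expansion[OF P S(1)] uV S(2) by blast
    also have "\<dots> \<in> span {s\<in>S. ev s = \<mu>}"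
    proof (rule span_sum)
      fix s assume s: "s \<in> S"
      show "(P u s / P s s) *s s \<in> span {s \<in> S. ev s = \<mu>}"
      proof (cases "ev s = \<mu>")
        case True
        then show ?thesis using s by (intro span_scale span_base) simp
      next
        case False
        then show ?thesis using zero[OF s] by (simp add: span_zero)
      qed
    qed
    finally show "u \<in> span {s\<in>S. ev s = \<mu>}" .
  qed
qed

text \<open>
  An eigenvector basis diagonalizes both forms at once.
\<close>

lemma forms_of_eigenvector_expansion:
  assumes A: "symmetric_form A" and P: "symmetric_form P"
    and S: "orthogonal_system P S" "span S = V"
    and ev: "\<And>s. s \<in> S \<Longrightarrow> s \<in> eigenspace A P V (ev s)" and v: "v \<in> V"
  shows "P v v = (\<Sum>s\<in>S. (P v s)\<^sup>2 / P s s)"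
    and "A v v = (\<Sum>s\<in>S. ev s * ((P v s)\<^sup>2 / P s s))"
proof -
  have v_eq: "v = (\<Sum>s\<in>S. (P v s / P s s) *s s)"
    using fourier_expansion[OF P S(1)] v S(2) by blast
  have "P v v = (\<Sum>s\<in>S. (P v s / P s s) * P v s)"
    by (subst (2) v_eq) (simp only: form_sum_right[OF P] form_scale_right[OF P])
  then show "P v v = (\<Sum>s\<in>S. (P v s)\<^sup>2 / P s s)"
    by (simp add: power2_eq_square)
  have Av: "A v s = ev s * P v s" if "s \<in> S" for s
    using ev[OF that] v by (simp add: eigenspace_def form_commute[OF A, of v] form_commute[OF P, of v])
  have "A v v = (\<Sum>s\<in>S. (P v s / P s s) * A v s)"
    by (subst (2) v_eq) (simp only: form_sum_right[OF A] form_scale_right[OF A])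
  then show "A v v = (\<Sum>s\<in>S. ev s * ((P v s)\<^sup>2 / P s s))"
    using Av by (simp add: power2_eq_square mult_ac)
qed

end

section \<open>The ordered list of eigenvalues\<close>

lemma sorted_concat_replicate:
  fixes xs :: "'a::linorder list"
  shows "sorted xs \<Longrightarrow> sorted (concat (map (\<lambda>x. replicate (m x) x) xs))"
  by (induction xs) (auto simp: sorted_append)

lemma nth_0_sorted:
  fixes xs :: "'a::linorder list"
  assumes "sorted xs" "x \<in> set xs" shows "xs ! 0 \<le> x"
  using assms by (metis in_set_conv_nth sorted_nth_mono zero_le)

lemma nth_last_sorted:
  fixes xs :: "'a::linorder list"
  assumes "sorted xs" "x \<in> set xs" shows "x \<le> xs ! (length xs - 1)"
proof -
  obtain i where "i < length xs" "xs ! i = x" using assms(2) by (auto simp: in_set_conv_nth)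
  then show ?thesis using sorted_nth_mono[OF assms(1), of i "length xs - 1"] by auto
qed

context real_space
begin

text \<open>
  The list \<open>L\<close> is sorted, its members are the eigenvalues of a basis of eigenvectors, and since the
  multiplicity of an eigenvalue counts the basis vectors that carry it, the length of \<open>L\<close> is the dimension
  of \<open>V\<close>. The bounds compare the two diagonal expansions term by term.
\<close>

lemma extreme_eigenvalues:
  assumes A: "symmetric_form A" and P: "symmetric_form P" and pos: "positive_on P V"
    and V: "subspace V" and F: "finite F" "V \<subseteq> span F" and dim: "dim V > 0"
  defines "L \<equiv> concat (map (\<lambda>\<mu>. replicate (dim (eigenspace A P V \<mu>)) \<mu>)
    (sorted_list_of_set {\<mu>. \<exists>u\<in>eigenspace A P V \<mu>. u \<noteq> 0}))"
  shows "\<exists>u\<in>V. u \<noteq> 0 \<and> A u u = L ! 0 * P u u"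
    and "\<exists>u\<in>V. u \<noteq> 0 \<and> A u u = L ! (dim V - 1) * P u u"
    and "\<And>v. v \<in> V \<Longrightarrow> L ! 0 * P v v \<le> A v v"
    and "\<And>v. v \<in> V \<Longrightarrow> A v v \<le> L ! (dim V - 1) * P v v"
proof -
  obtain S ev where S: "orthogonal_system P S" "span S = V"
    and ev: "\<And>s. s \<in> S \<Longrightarrow> s \<in> eigenspace A P V (ev s)"
    using eigenvector_basis[OF A P pos V F] by blast
  have fin: "finite S" and ps: "\<And>s. s \<in> S \<Longrightarrow> P s s > 0"
    using S by (auto simp: orthogonal_system_def)
  have ind: "independent S" using orthogonal_system_independent[OF P S(1)] .
  have card: "card S = dim V"
    using dim_span_eq_card_independent[OF ind] S(2) by simp
  define E where "E = {\<mu>. \<exists>u\<in>eigenspace A P V \<mu>. u \<noteq> 0}"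
  have eig: "eigenspace A P V \<mu> = span {s\<in>S. ev s = \<mu>}" for \<mu>
    using eigenspace_eq_span[OF A P S ev] .
  have mult: "dim (eigenspace A P V \<mu>) = card {s\<in>S. ev s = \<mu>}" for \<mu>
    unfolding eig using independent_mono[OF ind] by (intro dim_span_eq_card_independent) auto
  have E: "E = ev ` S"
  proof (intro equalityI subsetI)
    fix \<mu> assume "\<mu> \<in> E"
    then have "{s\<in>S. ev s = \<mu>} \<noteq> {}" by (auto simp: E_def eig simp del: Collect_empty_eq)
    then show "\<mu> \<in> ev ` S" by auto
  next
    fix \<mu> assume "\<mu> \<in> ev ` S"
    then obtain s where s: "s \<in> S" "\<mu> = ev s" by blast
    then have "s \<noteq> 0" using ps[of s] form_zero_left[OF P] by auto
    then show "\<mu> \<in> E" using ev[OF s(1)] s by (auto simp: E_def)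
  qed
  then have finE: "finite E" using fin by simp
  have L: "L = concat (map (\<lambda>\<mu>. replicate (card {s\<in>S. ev s = \<mu>}) \<mu>) (sorted_list_of_set E))"
    unfolding L_def E_def mult ..
  have "length L = (\<Sum>\<mu>\<in>E. card {s\<in>S. ev s = \<mu>})"
    unfolding L by (simp add: length_concat comp_def sum_list_distinct_conv_sum_set finE)
  also have "\<dots> = card S"
    using sum.group[OF fin finE, of ev "\<lambda>_. 1::nat"] E by simp
  finally have len: "length L = dim V" using card by simp
  have setL: "set L = E"
  proof -
    have "card {s\<in>S. ev s = \<mu>} \<noteq> 0" if "\<mu> \<in> E" for \<mu>
      using that fin by (auto simp: E)
    then show ?thesis unfolding L using finE by auto
  qed
  have sorted: "sorted L"
    unfolding L by (intro sorted_concat_replicate) simp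
  have attain: "\<exists>u\<in>V. u \<noteq> 0 \<and> A u u = L ! i * P u u" if "i < dim V" for i
  proof -
    have "L ! i \<in> E" using that len setL nth_mem by metis
    then show ?thesis by (auto simp: E_def eigenspace_def)
  qed
  show "\<exists>u\<in>V. u \<noteq> 0 \<and> A u u = L ! 0 * P u u"
    and "\<exists>u\<in>V. u \<noteq> 0 \<and> A u u = L ! (dim V - 1) * P u u"
    using attain dim by simp_all
  have bounds: "L ! 0 \<le> ev s" "ev s \<le> L ! (dim V - 1)" if "s \<in> S" for s
    using nth_0_sorted[OF sorted, of "ev s"] nth_last_sorted[OF sorted, of "ev s"] that setL len E
    by auto
  fix v assume v: "v \<in> V"
  have sq: "(P v s)\<^sup>2 / P s s \<ge> 0" if "s \<in> S" for s
    using ps[OF that] by simp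
  have Pv: "P v v = (\<Sum>s\<in>S. (P v s)\<^sup>2 / P s s)"
    and Av: "A v v = (\<Sum>s\<in>S. ev s * ((P v s)\<^sup>2 / P s s))"
    using forms_of_eigenvector_expansion[OF A P S _ v] ev by blast+
  show "L ! 0 * P v v \<le> A v v"
    unfolding Pv Av sum_distrib_left by (intro sum_mono mult_right_mono bounds sq)
  show "A v v \<le> L ! (dim V - 1) * P v v"
    unfolding Pv Av sum_distrib_left by (intro sum_mono mult_right_mono bounds sq)
qed

end

section \<open>The weak form of the Sturm--Liouville problem\<close>

interpretation fun_space: real_space "\<lambda>(c::real) (f::real \<Rightarrow> real) t. c * f t"
  by unfold_locales (auto simp: fun_eq_iff algebra_simps)

definition energy_form where
  "energy_form a h \<alpha> N p q y z =
    (\<Sum>k=1..N. p (grid a h k) * backward_diff h \<alpha> (\<lambda>i. y (grid a h i)) k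
        * backward_diff h \<alpha> (\<lambda>i. z (grid a h i)) k
      + q (grid a h k) * y (grid a h k) * z (grid a h k))"

definition weight_form where
  "weight_form a h N r y z = (\<Sum>k=1..N. r (grid a h k) * y (grid a h k) * z (grid a h k))"

definition admissible :: "real \<Rightarrow> real \<Rightarrow> nat \<Rightarrow> (real \<Rightarrow> real) set" where
  "admissible a h N = {y. SL_boundary a h N y \<and> (\<forall>t. t \<notin> grid_set a h N \<longrightarrow> y t = 0)}"

text \<open>
  Up to the common factor, both sides sum \<open>gl_coeff \<alpha> i * F k * z j\<close> over the
  triangle of indices with \<open>k = j + i \<le> N\<close>; only the order of summation differs.
\<close>

lemma summation_by_parts:
  "(\<Sum>k=0..N. F k * backward_diff h \<alpha> z k) = (\<Sum>j=0..N. forward_diff h \<alpha> N F j * z j)"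
proof -
  have "(\<Sum>k=0..N. F k * (\<Sum>i=0..k. gl_coeff \<alpha> i * z (k - i)))
      = (\<Sum>(k, i)\<in>(SIGMA k:{0..N}. {0..k}). F k * gl_coeff \<alpha> i * z (k - i))"
    by (simp add: sum_distrib_left sum.Sigma mult.assoc)
  also have "\<dots> = (\<Sum>(j, i)\<in>(SIGMA j:{0..N}. {0..N - j}). gl_coeff \<alpha> i * F (j + i) * z j)"
    by (rule sum.reindex_bij_witness[where i = "\<lambda>(j, i). (j + i, i)" and j = "\<lambda>(k, i). (k - i, i)"])
       auto
  also have "\<dots> = (\<Sum>j=0..N. (\<Sum>i=0..N - j. gl_coeff \<alpha> i * F (j + i)) * z j)"
    by (simp add: sum_distrib_right sum.Sigma)
  finally have "1 / h powr \<alpha> * (\<Sum>k=0..N. F k * (\<Sum>i=0..k. gl_coeff \<alpha> i * z (k - i)))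
      = 1 / h powr \<alpha> * (\<Sum>j=0..N. (\<Sum>i=0..N - j. gl_coeff \<alpha> i * F (j + i)) * z j)"
    by simp
  then show ?thesis
    unfolding backward_diff_def forward_diff_def
    by (simp only: sum_distrib_left mult_ac)
qed

lemma backward_diff_cong:
  "(\<And>i. i \<le> k \<Longrightarrow> f i = g i) \<Longrightarrow> backward_diff h \<alpha> f k = backward_diff h \<alpha> g k"
  by (simp add: backward_diff_def)

lemma
  assumes "\<And>i. i \<le> N \<Longrightarrow> y (grid a h i) = y' (grid a h i)"
  shows energy_form_cong: "energy_form a h \<alpha> N p q y = energy_form a h \<alpha> N p q y'"
    and weight_form_cong: "weight_form a h N r y = weight_form a h N r y'"
proof -
  have "backward_diff h \<alpha> (\<lambda>i. y (grid a h i)) k = backward_diff h \<alpha> (\<lambda>i. y' (grid a h i)) k"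
    if "k \<le> N" for k
    using that assms by (intro backward_diff_cong) auto
  then show "energy_form a h \<alpha> N p q y = energy_form a h \<alpha> N p q y'"
    "weight_form a h N r y = weight_form a h N r y'"
    using assms by (auto simp: energy_form_def weight_form_def fun_eq_iff intro!: sum.cong)
qed

lemma symmetric_weight_form: "fun_space.symmetric_form (weight_form a h N r)"
  unfolding fun_space.symmetric_form_def weight_form_def
  by (simp add: distrib_left distrib_right sum.distrib sum_distrib_left mult_ac)

lemma backward_diff_add:
  "backward_diff h \<alpha> (\<lambda>i. f i + g i) k = backward_diff h \<alpha> f k + backward_diff h \<alpha> g k"
  by (simp add: backward_diff_def algebra_simps sum.distrib add_divide_distrib)

lemma backward_diff_scale: "backward_diff h \<alpha> (\<lambda>i. c * f i) k = c * backward_diff h \<alpha> f k"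
  by (simp add: backward_diff_def sum_distrib_left mult_ac)

lemma symmetric_energy_form: "fun_space.symmetric_form (energy_form a h \<alpha> N p q)"
  unfolding fun_space.symmetric_form_def energy_form_def
  by (simp add: backward_diff_add backward_diff_scale distrib_left distrib_right sum.distrib
      sum_distrib_left mult_ac)

text \<open>
  The energy omits \<open>k = 0\<close> and the equation is imposed for \<open>k = 1, \<dots>, N - 1\<close> only, whereas summation by parts
  runs over all of \<open>{0..N}\<close>. The boundary values of \<open>z\<close> account for the difference: they remove the terms at
  both ends, and \<open>z (grid a h 0) = 0\<close> also makes the backward difference of \<open>z\<close> vanish at \<open>k = 0\<close>.
\<close>

lemma weak_form:
  assumes y: "SL_boundary a h N y" and z: "SL_boundary a h N z" and N: "N \<ge> 2"
  shows "energy_form a h \<alpha> N p q y z =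
    (\<Sum>k=1..N - 1. (forward_diff h \<alpha> N
       (\<lambda>j. p (grid a h j) * backward_diff h \<alpha> (\<lambda>i. y (grid a h i)) j) k
       + q (grid a h k) * y (grid a h k)) * z (grid a h k))"
    and "weight_form a h N r y z = (\<Sum>k=1..N - 1. r (grid a h k) * y (grid a h k) * z (grid a h k))"
proof -
  define F where "F j = p (grid a h j) * backward_diff h \<alpha> (\<lambda>i. y (grid a h i)) j" for j
  let ?z = "\<lambda>i. z (grid a h i)"
  have z0: "?z 0 = 0" and zN: "?z N = 0" using z by (auto simp: SL_boundary_def)
  have "k = 0 \<or> k = N" if "k \<in> {0..N} - {1..N - 1}" for k using that by auto
  then have vanish: "?z k = 0" if "k \<in> {0..N} - {1..N - 1}" for k using that z0 zN by metis
  have inner: "(\<Sum>k=0..N. G k * ?z k) = (\<Sum>k=1..N - 1. G k * ?z k)" for G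
    using vanish by (intro sum.mono_neutral_right) auto
  have inner1: "(\<Sum>k=1..N. G k * ?z k) = (\<Sum>k=1..N - 1. G k * ?z k)" for G
    using vanish by (intro sum.mono_neutral_right) auto
  have "(\<Sum>k=1..N. F k * backward_diff h \<alpha> ?z k) = (\<Sum>k=0..N. F k * backward_diff h \<alpha> ?z k)"
    using z0 by (intro sum.mono_neutral_left) (auto simp: backward_diff_def not_less_eq_eq)
  also have "\<dots> = (\<Sum>k=1..N - 1. forward_diff h \<alpha> N F k * ?z k)"
    by (simp only: summation_by_parts inner)
  finally show "energy_form a h \<alpha> N p q y z =
    (\<Sum>k=1..N - 1. (forward_diff h \<alpha> N
       (\<lambda>j. p (grid a h j) * backward_diff h \<alpha> (\<lambda>i. y (grid a h i)) j) k
       + q (grid a h k) * y (grid a h k)) * z (grid a h k))"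
    using inner1[of "\<lambda>k. q (grid a h k) * y (grid a h k)"]
    by (simp add: energy_form_def F_def[symmetric] distrib_right sum.distrib)
  show "weight_form a h N r y z = (\<Sum>k=1..N - 1. r (grid a h k) * y (grid a h k) * z (grid a h k))"
    unfolding weight_form_def by (rule inner1)
qed

lemma sum_fun_apply: "(\<Sum>i\<in>A. f i) x = (\<Sum>i\<in>A. f i x)"
  by (induction A rule: infinite_finite_induct) auto

definition bump :: "real \<Rightarrow> real \<Rightarrow> nat \<Rightarrow> real \<Rightarrow> real" where
  "bump a h k t = (if t = grid a h k then 1 else 0)"

lemma grid_eq_iff: "h > 0 \<Longrightarrow> grid a h i = grid a h j \<longleftrightarrow> i = j"
  by (simp add: grid_def)

lemma bump_grid: "h > 0 \<Longrightarrow> bump a h k (grid a h j) = (if j = k then 1 else 0)"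
  by (simp add: bump_def grid_eq_iff)

lemma bump_admissible:
  assumes "h > 0" "k \<in> {1..N - 1}" shows "bump a h k \<in> admissible a h N"
  using assms
  by (auto simp: admissible_def SL_boundary_def bump_grid grid_set_def) (auto simp: bump_def)

text \<open>
  The equations at \<open>k = 1, \<dots>, N - 1\<close> are recovered by testing against the functions that are 1 at a
  single inner grid point and 0 elsewhere.
\<close>

lemma SL_solution_iff_weak:
  assumes h: "h > 0" and N: "N \<ge> 2"
  shows "SL_solution a h \<alpha> N p q r \<mu> y \<longleftrightarrow> SL_boundary a h N y \<and>
    (\<forall>z\<in>admissible a h N. energy_form a h \<alpha> N p q y z = \<mu> * weight_form a h N r y z)"
proof (cases "SL_boundary a h N y")
  case y: True
  define G where "G k = forward_diff h \<alpha> N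
       (\<lambda>j. p (grid a h j) * backward_diff h \<alpha> (\<lambda>i. y (grid a h i)) j) k
       + q (grid a h k) * y (grid a h k) - \<mu> * r (grid a h k) * y (grid a h k)" for k
  have residual: "energy_form a h \<alpha> N p q y z - \<mu> * weight_form a h N r y z
      = (\<Sum>k=1..N - 1. G k * z (grid a h k))" if "z \<in> admissible a h N" for z
    using weak_form[OF y _ N, of z] that
    by (simp add: admissible_def G_def sum_distrib_left algebra_simps flip: sum_subtractf)
  have "(\<forall>k\<in>{1..N - 1}. G k = 0) \<longleftrightarrow>
      (\<forall>z\<in>admissible a h N. (\<Sum>k=1..N - 1. G k * z (grid a h k)) = 0)"
  proof
    assume R: "\<forall>z\<in>admissible a h N. (\<Sum>k=1..N - 1. G k * z (grid a h k)) = 0"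
    show "\<forall>k\<in>{1..N - 1}. G k = 0"
    proof
      fix k assume k: "k \<in> {1..N - 1}"
      have "(\<Sum>j=1..N - 1. G j * bump a h k (grid a h j)) = G k"
        using k by (simp add: bump_grid[OF h] if_distrib sum.delta cong: if_cong)
      then show "G k = 0" using R bump_admissible[OF h k] by auto
    qed
  qed simp
  then show ?thesis
    using y residual by (auto simp: SL_solution_def G_def)
qed (simp add: SL_solution_def)

lemma subspace_admissible: "fun_space.subspace (admissible a h N)"
  by (auto simp: fun_space.subspace_def admissible_def SL_boundary_def)

lemma nontrivial_iff_nonzero:
  assumes "y \<in> admissible a h N"
  shows "SL_nontrivial a h N y \<longleftrightarrow> y \<noteq> 0"
  using assms by (auto simp: SL_nontrivial_def admissible_def fun_eq_iff)

lemma weight_form_positive: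
  assumes r: "\<forall>i\<in>{0..N}. r (grid a h i) > 0" and y: "SL_boundary a h N y" "SL_nontrivial a h N y"
  shows "weight_form a h N r y y > 0"
proof -
  obtain j where j: "j \<le> N" "y (grid a h j) \<noteq> 0"
    using y(2) by (auto simp: SL_nontrivial_def grid_set_def)
  have "j \<noteq> 0" using j y(1) by (auto simp: SL_boundary_def intro: ccontr)
  then have j1: "j \<in> {1..N}" using j by simp
  show ?thesis
    unfolding weight_form_def
  proof (rule sum_pos2[OF _ j1])
    show "0 < r (grid a h j) * y (grid a h j) * y (grid a h j)"
      using r j by (metis atLeastAtMost_iff mult.assoc mult_pos_pos not_real_square_gt_zero zero_le)
    show "0 \<le> r (grid a h i) * y (grid a h i) * y (grid a h i)" if "i \<in> {1..N}" for i
      using r that by (simp add: mult.assoc less_imp_le)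
  qed simp
qed

lemma weight_form_positive_on:
  assumes "\<forall>i\<in>{0..N}. r (grid a h i) > 0"
  shows "fun_space.positive_on (weight_form a h N r) (admissible a h N)"
  using weight_form_positive[OF assms] nontrivial_iff_nonzero
  by (auto simp: fun_space.positive_on_def admissible_def)

text \<open>
  The functions supported at one inner grid point form a basis. Their independence follows from their
  orthogonality for the weight 1.
\<close>

lemma
  assumes h: "h > 0" and N: "N \<ge> 2"
  shows admissible_subset_span_bumps: "admissible a h N \<subseteq> fun_space.span (bump a h ` {1..N - 1})"
    and dim_admissible: "fun_space.dim (admissible a h N) = N - 1"
proof -
  let ?B = "bump a h ` {1..N - 1}"
  have inj: "inj_on (bump a h) {1..N - 1}"
  proof (rule inj_onI)
    fix i j assume "bump a h i = bump a h j"
    then have "bump a h j (grid a h i) = 1" using bump_grid[OF h, of a i i] by metis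
    then show "i = j" using bump_grid[OF h, of a j i] by (simp split: if_splits)
  qed
  have w: "weight_form a h N (\<lambda>_. 1) (bump a h i) (bump a h j) = (if i = j then 1 else 0)"
    if "i \<in> {1..N - 1}" for i j
  proof -
    have "weight_form a h N (\<lambda>_. 1) (bump a h i) (bump a h j)
        = (\<Sum>k=1..N. if k = i then (if i = j then 1 else 0) else 0)"
      unfolding weight_form_def by (intro sum.cong) (auto simp: bump_grid[OF h])
    then show ?thesis using that by auto
  qed
  have "fun_space.orthogonal_system (weight_form a h N (\<lambda>_. 1)) ?B"
    by (auto simp: fun_space.orthogonal_system_def w)
  then have ind: "fun_space.independent ?B"
    by (rule fun_space.orthogonal_system_independent[OF symmetric_weight_form])
  show span: "admissible a h N \<subseteq> fun_space.span ?B"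
  proof
    fix y assume y: "y \<in> admissible a h N"
    have "y = (\<Sum>k=1..N - 1. (\<lambda>t. y (grid a h k) * bump a h k t))"
    proof
      fix t
      show "y t = (\<Sum>k=1..N - 1. (\<lambda>t. y (grid a h k) * bump a h k t)) t"
      proof (cases "t \<in> grid a h ` {1..N - 1}")
        case True
        then obtain j where "j \<in> {1..N - 1}" "t = grid a h j" by blast
        then show ?thesis
          by (simp add: sum_fun_apply bump_grid[OF h] if_distrib sum.delta cong: if_cong)
      next
        case False
        have "y t = 0"
        proof (cases "t \<in> grid_set a h N")
          case True
          then obtain j where "j \<le> N" "t = grid a h j" by (auto simp: grid_set_def)
          with False have "j = 0 \<or> j = N" by force
          then show ?thesis using y \<open>t = _\<close> by (auto simp: admissible_def SL_boundary_def)
        qed (use y in \<open>auto simp: admissible_def\<close>)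
        moreover have "bump a h k t = 0" if "k \<in> {1..N - 1}" for k
          using False that by (auto simp: bump_def)
        ultimately show ?thesis by (simp add: sum_fun_apply)
      qed
    qed
    also have "\<dots> \<in> fun_space.span ?B"
      by (intro fun_space.span_sum fun_space.span_scale fun_space.span_base) simp
    finally show "y \<in> fun_space.span ?B" .
  qed
  have "?B \<subseteq> admissible a h N" using bump_admissible[OF h] by blast
  then show "fun_space.dim (admissible a h N) = N - 1"
    using fun_space.dim_unique[OF _ span ind] card_image[OF inj] by simp
qed

definition restrict_to_grid :: "real \<Rightarrow> real \<Rightarrow> nat \<Rightarrow> (real \<Rightarrow> real) \<Rightarrow> real \<Rightarrow> real" where
  "restrict_to_grid a h N y t = (if t \<in> grid_set a h N then y t else 0)"

lemma restrict_to_grid_apply: "i \<le> N \<Longrightarrow> restrict_to_grid a h N y (grid a h i) = y (grid a h i)"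
  by (simp add: restrict_to_grid_def grid_set_def)

lemma restrict_to_grid_admissible:
  "SL_boundary a h N y \<Longrightarrow> restrict_to_grid a h N y \<in> admissible a h N"
  by (auto simp: admissible_def SL_boundary_def restrict_to_grid_def)

lemma restrict_to_grid_nontrivial:
  "SL_nontrivial a h N (restrict_to_grid a h N y) \<longleftrightarrow> SL_nontrivial a h N y"
  by (auto simp: SL_nontrivial_def restrict_to_grid_def)

lemma SL_eigenspace_eq:
  assumes "h > 0" "N \<ge> 2"
  shows "SL_eigenspace a h \<alpha> N p q r \<mu> =
    fun_space.eigenspace (energy_form a h \<alpha> N p q) (weight_form a h N r) (admissible a h N) \<mu>"
  by (auto simp: SL_eigenspace_def fun_space.eigenspace_def SL_solution_iff_weak[OF assms]
      admissible_def)

text \<open>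
  An eigenfunction may have arbitrary values off the grid; restricting it to the grid gives an element of
  the eigenspace.
\<close>

lemma SL_eigenvalue_iff:
  assumes "h > 0" "N \<ge> 2"
  shows "SL_eigenvalue a h \<alpha> N p q r \<mu> \<longleftrightarrow> (\<exists>u\<in>fun_space.eigenspace
    (energy_form a h \<alpha> N p q) (weight_form a h N r) (admissible a h N) \<mu>. u \<noteq> 0)"
proof
  assume "SL_eigenvalue a h \<alpha> N p q r \<mu>"
  then obtain y where y: "SL_nontrivial a h N y" "SL_solution a h \<alpha> N p q r \<mu> y"
    by (auto simp: SL_eigenvalue_def)
  define u where "u = restrict_to_grid a h N y"
  have "energy_form a h \<alpha> N p q u = energy_form a h \<alpha> N p q y"
    and "weight_form a h N r u = weight_form a h N r y"
    unfolding u_def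
    by (rule energy_form_cong weight_form_cong; simp add: restrict_to_grid_apply)+
  moreover have "u \<in> admissible a h N"
    using y by (auto simp: u_def SL_solution_def intro: restrict_to_grid_admissible)
  moreover from this have "u \<noteq> 0"
    using y(1) restrict_to_grid_nontrivial by (simp add: u_def flip: nontrivial_iff_nonzero)
  ultimately show "\<exists>u\<in>fun_space.eigenspace (energy_form a h \<alpha> N p q) (weight_form a h N r)
      (admissible a h N) \<mu>. u \<noteq> 0"
    using y SL_solution_iff_weak[OF assms] by (auto simp: fun_space.eigenspace_def)
next
  assume "\<exists>u\<in>fun_space.eigenspace (energy_form a h \<alpha> N p q) (weight_form a h N r)
      (admissible a h N) \<mu>. u \<noteq> 0"
  then obtain u where u: "u \<in> SL_eigenspace a h \<alpha> N p q r \<mu>" "u \<noteq> 0"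
    unfolding SL_eigenspace_eq[OF assms] by blast
  then have "u \<in> admissible a h N"
    by (simp add: SL_eigenspace_def admissible_def SL_solution_def)
  then have "SL_nontrivial a h N u"
    using u(2) nontrivial_iff_nonzero by blast
  then show "SL_eigenvalue a h \<alpha> N p q r \<mu>"
    using u(1) by (auto simp: SL_eigenvalue_def SL_eigenspace_def)
qed

lemma rayleigh_eq_forms:
  "rayleigh a h \<alpha> N p q r y = energy_form a h \<alpha> N p q y y / weight_form a h N r y y"
  by (simp add: rayleigh_def SL_J_def SL_I_def energy_form_def weight_form_def power2_eq_square
      mult.assoc)

lemma rayleigh_restrict_to_grid:
  "rayleigh a h \<alpha> N p q r (restrict_to_grid a h N y) = rayleigh a h \<alpha> N p q r y"
proof -
  let ?u = "restrict_to_grid a h N y"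
  have A: "energy_form a h \<alpha> N p q ?u = energy_form a h \<alpha> N p q y"
    and W: "weight_form a h N r ?u = weight_form a h N r y"
    by (rule energy_form_cong weight_form_cong; simp add: restrict_to_grid_apply)+
  have "energy_form a h \<alpha> N p q ?u ?u = energy_form a h \<alpha> N p q y y"
    using A fun_space.form_commute[OF symmetric_energy_form] by metis
  moreover have "weight_form a h N r ?u ?u = weight_form a h N r y y"
    using W fun_space.form_commute[OF symmetric_weight_form] by metis
  ultimately show ?thesis by (simp add: rayleigh_eq_forms)
qed

section \<open>Extrema of the Rayleigh quotient\<close>

theorem theorem2p7:
  fixes a h \<alpha> :: real and N :: nat and p q r y :: "real \<Rightarrow> real"
  assumes "h > 0" and "N \<ge> 2" and "0 < \<alpha>" and "\<alpha> \<le> 1"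
    and "\<forall>i\<in>{0..N}. p (grid a h i) > 0"
    and "\<forall>i\<in>{0..N}. r (grid a h i) > 0"
    and "SL_boundary a h N y" and "SL_nontrivial a h N y"
  shows
    "(is_arg_min (rayleigh a h \<alpha> N p q r) (\<lambda>z. SL_nontrivial a h N z \<and> SL_boundary a h N z) y
        \<longrightarrow> rayleigh a h \<alpha> N p q r y = SL_lambda a h \<alpha> N p q r 1)
     \<and> (is_arg_max (rayleigh a h \<alpha> N p q r) (\<lambda>z. SL_nontrivial a h N z \<and> SL_boundary a h N z) y
        \<longrightarrow> rayleigh a h \<alpha> N p q r y = SL_lambda a h \<alpha> N p q r (N - 1))"
proof -
  note h = assms(1) and N = assms(2) and r = assms(6) and y = assms(7,8)
  let ?A = "energy_form a h \<alpha> N p q" and ?W = "weight_form a h N r" and ?V = "admissible a h N"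
  let ?R = "rayleigh a h \<alpha> N p q r"
  define lo where "lo = SL_lambda a h \<alpha> N p q r 1"
  define hi where "hi = SL_lambda a h \<alpha> N p q r (N - 1)"
  have list: "SL_eigenvalues a h \<alpha> N p q r = concat (map (\<lambda>\<mu>. replicate
      (fun_space.dim (fun_space.eigenspace ?A ?W ?V \<mu>)) \<mu>)
      (sorted_list_of_set {\<mu>. \<exists>u\<in>fun_space.eigenspace ?A ?W ?V \<mu>. u \<noteq> 0}))"
    unfolding SL_eigenvalues_def SL_multiplicity_def SL_eigenspace_eq[OF h N]
      SL_eigenvalue_iff[OF h N] ..
  have dim: "fun_space.dim ?V = N - 1" using dim_admissible[OF h N] .
  then have "fun_space.dim ?V > 0" using N by simp
  note extreme = fun_space.extreme_eigenvalues[OF symmetric_energy_form[of a h \<alpha> N p q]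
      symmetric_weight_form weight_form_positive_on[OF r] subspace_admissible
      finite_imageI[OF finite_atLeastAtMost] admissible_subset_span_bumps[OF h N] this,
      folded list, unfolded dim]
  \<comment> \<open>The eigenvalues are numbered from 1 and list positions from 0, hence the double subtraction.\<close>
  have lo: "lo = SL_eigenvalues a h \<alpha> N p q r ! 0"
    and hi: "hi = SL_eigenvalues a h \<alpha> N p q r ! (N - 1 - 1)"
    by (simp_all add: lo_def hi_def SL_lambda_def)
  have bounds: "lo \<le> ?R z" "?R z \<le> hi" if "SL_boundary a h N z" "SL_nontrivial a h N z" for z
  proof -
    let ?u = "restrict_to_grid a h N z"
    have u: "?u \<in> ?V" using restrict_to_grid_admissible that by blast
    have "SL_nontrivial a h N ?u" using that by (simp add: restrict_to_grid_nontrivial)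
    then have "?W ?u ?u > 0" using weight_form_positive[OF r] u by (simp add: admissible_def)
    then have "lo \<le> ?R ?u" "?R ?u \<le> hi"
      using extreme(3,4)[OF u] by (simp_all add: lo hi rayleigh_eq_forms field_simps)
    then show "lo \<le> ?R z" "?R z \<le> hi" by (simp_all add: rayleigh_restrict_to_grid)
  qed
  have attained: "\<exists>z. SL_nontrivial a h N z \<and> SL_boundary a h N z \<and> ?R z = \<mu>"
    if ex: "\<exists>u\<in>?V. u \<noteq> 0 \<and> ?A u u = \<mu> * ?W u u" for \<mu>
  proof -
    obtain u where u: "u \<in> ?V" "u \<noteq> 0" "?A u u = \<mu> * ?W u u" using ex by blast
    then have b: "SL_nontrivial a h N u" "SL_boundary a h N u"
      using nontrivial_iff_nonzero by (auto simp: admissible_def)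
    then have "?W u u > 0" using weight_form_positive[OF r] by blast
    then have "?R u = \<mu>" using u by (simp add: rayleigh_eq_forms)
    then show ?thesis using b by blast
  qed
  have att: "\<exists>z. SL_nontrivial a h N z \<and> SL_boundary a h N z \<and> ?R z = lo"
    "\<exists>z. SL_nontrivial a h N z \<and> SL_boundary a h N z \<and> ?R z = hi"
    using attained[OF extreme(1)] attained[OF extreme(2)] by (simp_all add: lo hi)
  have "?R y = lo" if "is_arg_min ?R (\<lambda>z. SL_nontrivial a h N z \<and> SL_boundary a h N z) y"
    using that att(1) bounds(1)[OF y] by (force simp: is_arg_min_def)
  moreover have "?R y = hi" if "is_arg_max ?R (\<lambda>z. SL_nontrivial a h N z \<and> SL_boundary a h N z) y"
    using that att(2) bounds(2)[OF y] by (force simp: is_arg_max_def)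
  ultimately show ?thesis by (simp add: lo_def hi_def)
qed

end
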